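(* Let $A,B,C$ be the vertices of a non-regular (i.e. non-equilateral) triangle in the plane, labelled so that $C$ is not on the perpendicular bisector $m$ of the segment $AB$, and $C$ and $B$ lie on the same side of $m$. Let $0<\alpha<45^{\circ}$, and let the points $P,E,G,D_\alpha$ be constructed as follows: (1) $P$ is a point on the line $AB$ such that $A$ and $P$ are separated by the point $B$ (i.e. $B$ lies strictly between $A$ and $P$) and the angle enclosed by the lines $PB$ and $PC$ is of measure $\alpha$; (2) $E$ is a point of $m$ such that the line $CE$ intersects $m$ under an angle of measure $\alpha$, and $G$ is a point on the line $PC$ such that $EGC$ is a (non-degenerate) triangle having a right angle at $G$; (3) $D_\alpha$ is the reflection of $C$ about the point $G$, i.e. $D_\alpha=2G-C$. Then the set $H_\alpha=\{A,B,C,D_\alpha\}$ has the discrete Pompeiu property with respect to the isometry group of $\mathbb{R}^2$.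
   Context: Let $\mathcal{G}$ be a family of bijections of a set $X$ onto itself. A nonempty finite set $K\subset X$ has the discrete Pompeiu property with respect to $\mathcal{G}$ if the following holds: whenever $f\colon X\to\mathbb{C}$ is a function (no regularity assumed) such that $\sum_{x\in K}f(\phi(x))=0$ for every $\phi\in\mathcal{G}$, then $f\equiv 0$. *)

theory Defs
  imports "HOL-Analysis.Analysis"
begin

text \<open>
  A function \<open>X \<rightarrow> \<complex>\<close> is represented by a total function, of which only the values on \<open>X\<close> matter.
\<close>

definition discrete_pompeiu :: "'a set \<Rightarrow> ('a \<Rightarrow> 'a) set \<Rightarrow> 'a set \<Rightarrow> bool" where
  "discrete_pompeiu X \<G> K \<longleftrightarrow>
     (\<forall>\<phi>\<in>\<G>. bij_betw \<phi> X X) \<and>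
     K \<noteq> {} \<and> finite K \<and> K \<subseteq> X \<and>
     (\<forall>f :: 'a \<Rightarrow> complex.
        (\<forall>\<phi>\<in>\<G>. (\<Sum>x\<in>K. f (\<phi> x)) = 0) \<longrightarrow> (\<forall>x\<in>X. f x = 0))"

definition isometry_group :: "('a :: metric_space \<Rightarrow> 'a) set" where
  "isometry_group = {\<phi>. bij \<phi> \<and> (\<forall>x y. dist (\<phi> x) (\<phi> y) = dist x y)}"

text \<open>
  In the plane, the following set is the line through the midpoint of \<open>A\<close> and \<open>B\<close>
  perpendicular to the line \<open>AB\<close> (for \<open>A \<noteq> B\<close>).
\<close>

definition perp_bisector :: "real^2 \<Rightarrow> real^2 \<Rightarrow> (real^2) set" where
  "perp_bisector A B = {X. orthogonal (X - midpoint A B) (B - A)}"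

definition same_side :: "(real^2) set \<Rightarrow> real^2 \<Rightarrow> real^2 \<Rightarrow> bool" where
  "same_side L X Y \<longleftrightarrow> closed_segment X Y \<inter> L = {}"

text \<open>
  The angle between two intersecting lines is the non-obtuse one, in \<open>[0, \<pi>/2]\<close> and in radians;
  hence the absolute value of the inner product. Here \<open>p\<close> is a common point of the lines \<open>L\<close>
  and \<open>M\<close>, and \<open>q\<close>, \<open>r\<close> are further points of \<open>L\<close>, \<open>M\<close>; the value does not depend on the choice.
\<close>

definition lines_meet_at_angle :: "(real^2) set \<Rightarrow> (real^2) set \<Rightarrow> real \<Rightarrow> bool" where
  "lines_meet_at_angle L M \<theta> \<longleftrightarrow>
     (\<exists>p q r. q \<noteq> p \<and> r \<noteq> p \<and>
        L = affine hull {p, q} \<and> M = affine hull {p, r} \<and>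
        \<theta> = arccos (\<bar>(q - p) \<bullet> (r - p)\<bar> / (norm (q - p) * norm (r - p))))"

end

theory Submission
  imports Defs
begin

text \<open>
  Let \<open>\<sigma>\<close> be the reflection in the perpendicular bisector \<open>m\<close> of \<open>A\<close> and \<open>B\<close>, and \<open>\<tau>\<close> the
  reflection in the line \<open>E G\<close>. Then \<open>\<sigma>\<close> swaps \<open>A\<close> and \<open>B\<close>, and \<open>\<tau>\<close> maps \<open>C\<close> to \<open>D\<close>, because
  \<open>E G\<close> is the perpendicular bisector of \<open>C\<close> and \<open>D\<close>. Both \<open>E G\<close>, which is perpendicular to
  \<open>P C\<close>, and \<open>E C\<close> make the angle \<open>\<alpha>\<close> with \<open>m\<close>; being different lines they are mirror images
  in \<open>m\<close>, so \<open>\<sigma> C\<close> lies on \<open>E G\<close>. Hence \<open>D\<close>, \<open>\<sigma> C\<close>, \<open>C\<close>, \<open>\<sigma> D\<close> are equally spaced, with step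
  \<open>2\<alpha>\<close>, on a circle about \<open>E\<close>.

  Suppose that the sum of \<open>f\<close> vanishes on all congruent copies of \<open>{A, B, C, D}\<close>. Subtracting
  the sums for \<open>\<phi>\<close> and \<open>\<phi> \<circ> \<sigma>\<close> removes \<open>A\<close> and \<open>B\<close> and leaves an alternating sum of \<open>f\<close> over
  the four equally spaced points. Adding to it the same relation turned by one step makes the
  terms telescope: only the two outermost of the five points remain, and \<open>f\<close> agrees on them
  (\<open>outer_values_agree\<close>). They are separated by the angle \<open>8\<alpha>\<close> about \<open>E\<close>, which is strictly
  between \<open>0\<close> and a full turn, so they are distinct (\<open>reflection_moves_outer_point\<close>). Thus
  \<open>f\<close> agrees on any two points at one fixed positive distance, which in the plane forces \<open>f\<close>
  to be constant (\<open>constant_if_equal_at_distance\<close>). As \<open>A\<close>, \<open>B\<close>, \<open>C\<close>, \<open>D\<close> are four points,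
  the constant is \<open>0\<close>.
\<close>

section \<open>Isometries\<close>

lemma isometry_group_comp:
  "\<phi> \<in> isometry_group \<Longrightarrow> \<psi> \<in> isometry_group \<Longrightarrow> \<phi> \<circ> \<psi> \<in> isometry_group"
  by (auto simp: isometry_group_def intro: bij_comp)

lemma isometry_group_add_orthogonal_transformation:
  fixes g :: "real^'n \<Rightarrow> real^'n"
  assumes "orthogonal_transformation g"
  shows "(\<lambda>z. g (z - p) + x) \<in> isometry_group"
proof -
  have "bij ((\<lambda>z. z + x) \<circ> g \<circ> (\<lambda>z. z - p))"
    using orthogonal_transformation_bij[OF assms]
    by (intro bij_comp) (auto simp: bij_plus_right bij_diff_right)
  moreover have "dist (g (z - p) + x) (g (y - p) + x) = dist z y" for z y
    using assms by (simp add: orthogonal_transformation_isometry) (simp add: dist_norm)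
  ultimately show ?thesis
    by (simp add: isometry_group_def comp_def)
qed

definition reflection :: "'a :: real_inner \<Rightarrow> 'a \<Rightarrow> 'a \<Rightarrow> 'a" where
  "reflection p n x = x - (2 * ((x - p) \<bullet> n)) *\<^sub>R n"

lemma reflection_reflection:
  assumes "norm n = 1"
  shows "reflection p n (reflection p n x) = x"
proof -
  have "n \<bullet> n = 1"
    using assms by (simp add: dot_square_norm)
  then have "(reflection p n x - p) \<bullet> n = - ((x - p) \<bullet> n)"
    by (simp add: reflection_def inner_diff_left)
  then show ?thesis
    unfolding reflection_def[of p n "reflection p n x"] by (simp add: reflection_def)
qed

lemma reflection_isometry:
  assumes "norm n = 1"
  shows "reflection p n \<in> isometry_group"
proof -
  have n: "n \<bullet> n = 1"
    using assms by (simp add: dot_square_norm)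
  have "dist (reflection p n x) (reflection p n y) = dist x y" for x y
  proof -
    define z where "z = x - y"
    have "reflection p n x - reflection p n y = z - (2 * (z \<bullet> n)) *\<^sub>R n"
      by (simp add: reflection_def z_def inner_diff_left algebra_simps)
    moreover have "norm (z - (2 * (z \<bullet> n)) *\<^sub>R n) = norm z"
      by (simp add: norm_eq inner_diff_left inner_diff_right inner_commute n algebra_simps)
    ultimately show ?thesis
      by (simp add: dist_norm z_def)
  qed
  moreover have "bij (reflection p n)"
    by (rule o_bij[where g = "reflection p n"])
      (auto simp: fun_eq_iff reflection_reflection[OF assms])
  ultimately show ?thesis
    by (simp add: isometry_group_def)
qed

lemma reflection_fixed_iff:
  assumes "norm n = 1"
  shows "reflection p n x = x \<longleftrightarrow> (x - p) \<bullet> n = 0"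
  using assms by (auto simp: reflection_def)

text \<open>
  A mirror with normal \<open>b - a\<close> through any point at equal distance from \<open>a\<close> and \<open>b\<close> also
  passes through their midpoint.
\<close>

lemma reflection_swaps:
  assumes "a \<noteq> b" and "(p - midpoint a b) \<bullet> (b - a) = 0"
  shows "reflection p (sgn (b - a)) a = b"
proof -
  have "(a - p) \<bullet> (b - a) = (a - midpoint a b) \<bullet> (b - a)"
    using assms(2) by (simp add: inner_diff_left)
  also have "\<dots> = - ((b - a) \<bullet> (b - a)) / 2"
    by (simp add: midpoint_def inner_diff_left inner_diff_right inner_add_left inner_add_right
        inner_commute field_simps)
  finally have "2 * ((a - p) \<bullet> sgn (b - a)) = - norm (b - a)"
    using assms(1)
    by (simp add: sgn_div_norm dot_square_norm power2_eq_square)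
  moreover have "norm (b - a) *\<^sub>R sgn (b - a) = b - a"
    using assms(1) by (simp add: sgn_div_norm)
  ultimately show ?thesis
    by (simp add: reflection_def)
qed

section \<open>Functions that agree at a fixed distance\<close>

text \<open>
  Two points at distance at most \<open>2 d\<close> are joined by two steps of length \<open>d\<close>, the legs of an
  isosceles triangle whose apex exists because the dimension is at least two. Therefore \<open>f\<close> is
  locally constant.
\<close>

lemma constant_if_equal_at_distance:
  fixes f :: "'a :: euclidean_space \<Rightarrow> 'b"
  assumes dim: "2 \<le> DIM('a)" and d: "0 < d"
    and eq: "\<And>x y. dist x y = d \<Longrightarrow> f x = f y"
  shows "f x = f y"
proof -
  have near: "f x = f y" if "dist y x < 2 * d" for x y
  proof -
    define k where "k = (1/2) *\<^sub>R (y - x)"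
    obtain u where u: "u \<noteq> 0" "orthogonal k u"
      using orthogonal_to_vector_exists[OF dim] by blast
    have k: "norm k < d"
      using that by (simp add: k_def dist_norm)
    define h where "h = sqrt (d\<^sup>2 - (norm k)\<^sup>2) *\<^sub>R sgn u"
    have "(norm k)\<^sup>2 < d\<^sup>2"
      using k by (simp add: power_strict_mono)
    then have h: "(norm h)\<^sup>2 = d\<^sup>2 - (norm k)\<^sup>2"
      using u by (simp add: h_def norm_sgn)
    have "orthogonal k h"
      using u by (simp add: h_def orthogonal_def sgn_div_norm)
    have "(norm (k + h))\<^sup>2 = d\<^sup>2" "(norm (k - h))\<^sup>2 = d\<^sup>2"
      using h \<open>orthogonal k h\<close> by (simp_all add: norm_add_Pythagorean orthogonal_clauses
          norm_add_Pythagorean[of k "- h", simplified])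
    then have "norm (k + h) = d" "norm (k - h) = d"
      using d by (simp_all add: power2_eq_iff_nonneg)
    moreover have "(x + (k + h)) - x = k + h" "y - (x + (k + h)) = k - h"
      by (simp_all add: k_def algebra_simps flip: scaleR_left.add scaleR_add_left)
    ultimately have "dist (x + (k + h)) x = d" "dist y (x + (k + h)) = d"
      by (simp_all only: dist_norm)
    then show ?thesis
      using eq dist_commute by metis
  qed
  show ?thesis
  proof (rule connected_local_const[of UNIV])
    show "\<forall>a\<in>UNIV. \<forall>\<^sub>F b in at a. f a = f b"
      using near d by (auto simp: eventually_at intro!: exI[of _ "2 * d"])
  qed (auto simp: connected_UNIV)
qed

text \<open>
  The isometry group acts transitively on the pairs of points at a given distance.
\<close>

lemma constant_if_equal_on_congruent_pairs:
  fixes f :: "real^'n \<Rightarrow> 'b"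
  assumes dim: "2 \<le> CARD('n)" and "p \<noteq> q"
    and eq: "\<And>\<phi>. \<phi> \<in> isometry_group \<Longrightarrow> f (\<phi> p) = f (\<phi> q)"
  shows "f x = f y"
proof (rule constant_if_equal_at_distance[where d = "dist q p"])
  fix x y :: "real^'n"
  assume "dist x y = dist q p"
  then obtain g where g: "orthogonal_transformation g" "g (q - p) = y - x"
    using orthogonal_transformation_exists[of "q - p" "y - x"]
    by (auto simp: dist_norm norm_minus_commute)
  then have "g 0 = 0"
    using linear_0 orthogonal_transformation_linear by blast
  then show "f x = f y"
    using eq[OF isometry_group_add_orthogonal_transformation[OF g(1)], of p x] g(2) by simp
qed (use assms in auto)

section \<open>The telescoping argument\<close>

text \<open>
  The sums for \<open>\<phi>\<close> and \<open>\<phi> \<circ> \<sigma>\<close> have the terms at \<open>A\<close> and \<open>B\<close> in common. When \<open>\<sigma>\<close> and \<open>\<tau>\<close>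
  are reflections in two lines through a point, \<open>\<sigma> \<circ> \<tau>\<close> is a rotation, and precomposing with
  it shifts the resulting four-term relation by one step.
\<close>

lemma outer_values_agree:
  fixes f :: "'a \<Rightarrow> 'b :: ab_group_add"
  assumes sum0: "\<And>\<phi>. \<phi> \<in> \<G> \<Longrightarrow> f (\<phi> A) + f (\<phi> B) + f (\<phi> C) + f (\<phi> D) = 0"
    and comp: "\<And>\<phi> \<psi>. \<phi> \<in> \<G> \<Longrightarrow> \<psi> \<in> \<G> \<Longrightarrow> \<phi> \<circ> \<psi> \<in> \<G>"
    and \<sigma>: "\<sigma> \<in> \<G>" "\<And>x. \<sigma> (\<sigma> x) = x" "\<sigma> A = B"
    and \<tau>: "\<tau> \<in> \<G>" "\<And>x. \<tau> (\<tau> x) = x" "\<tau> C = D" "\<tau> (\<sigma> C) = \<sigma> C"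
    and \<phi>: "\<phi> \<in> \<G>"
  shows "f (\<phi> D) = f (\<phi> (\<sigma> (\<tau> (\<sigma> D))))"
proof -
  have "\<sigma> B = A" "\<tau> D = C"
    using \<sigma> \<tau> by metis+
  have four_terms: "f (\<psi> C) + f (\<psi> D) = f (\<psi> (\<sigma> C)) + f (\<psi> (\<sigma> D))" if "\<psi> \<in> \<G>" for \<psi>
  proof -
    have "f (\<psi> A) + f (\<psi> B) + (f (\<psi> C) + f (\<psi> D)) = 0"
      using sum0[OF that] by (simp add: add.assoc)
    moreover have "f (\<psi> A) + f (\<psi> B) + (f (\<psi> (\<sigma> C)) + f (\<psi> (\<sigma> D))) = 0"
      using sum0[OF comp[OF that \<sigma>(1)]] \<sigma>(3) \<open>\<sigma> B = A\<close> by (simp add: ac_simps)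
    ultimately show ?thesis
      by (metis add_left_cancel)
  qed
  have "\<phi> \<circ> \<sigma> \<circ> \<tau> \<in> \<G>"
    using \<phi> \<sigma>(1) \<tau>(1) comp by blast
  then have "f (\<phi> (\<sigma> D)) + f (\<phi> (\<sigma> C)) = f (\<phi> C) + f (\<phi> (\<sigma> (\<tau> (\<sigma> D))))"
    using four_terms[of "\<phi> \<circ> \<sigma> \<circ> \<tau>"] \<sigma>(2) \<tau>(3,4) \<open>\<tau> D = C\<close> by simp
  with four_terms[OF \<phi>] show ?thesis
    by (metis add.commute add_left_cancel)
qed

text \<open>
  The equation for \<open>(c - p) \<bullet> v\<close> says that the image of \<open>c\<close> in the mirror with normal \<open>n\<close> lies
  on the mirror with normal \<open>v\<close>. If \<open>\<alpha>\<close> is the angle between the mirrors, then in the plane \<open>c\<close>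
  and \<open>d\<close> are seen from \<open>p\<close> at angle \<open>2\<alpha>\<close> on either side of the second mirror, and
  \<open>reflection p n d\<close> is seen at angle \<open>4\<alpha>\<close> from it. So its distance from that mirror is that of
  \<open>c\<close> multiplied by \<open>\<bar>sin 4\<alpha> / sin 2\<alpha>\<bar> = 2 \<bar>cos 2\<alpha>\<bar>\<close>, where \<open>cos 2\<alpha> = 2 (n \<bullet> v)\<^sup>2 - 1\<close>.
\<close>

lemma reflection_moves_outer_point:
  fixes n v :: "'a :: real_inner"
  assumes n: "norm n = 1" and v: "norm v = 1"
    and c: "(c - p) \<bullet> v = 2 * ((c - p) \<bullet> n) * (n \<bullet> v)" "(c - p) \<bullet> v \<noteq> 0"
    and angle: "2 * (n \<bullet> v)\<^sup>2 \<noteq> 1"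
  defines "d \<equiv> reflection p v c"
  shows "reflection p v (reflection p n d) \<noteq> reflection p n d"
proof -
  have nn: "n \<bullet> n = 1" and vv: "v \<bullet> v = 1"
    using n v by (simp_all add: dot_square_norm)
  define w where "w = c - p"
  have "d - p = w - (2 * (w \<bullet> v)) *\<^sub>R v"
    by (simp add: d_def reflection_def w_def)
  then have d: "(d - p) \<bullet> v = - (w \<bullet> v)" "(d - p) \<bullet> n = w \<bullet> n - 2 * (w \<bullet> v) * (n \<bullet> v)"
    using vv by (simp_all add: inner_diff_left inner_commute[of v n])
  have "(reflection p n d - p) \<bullet> v = (d - p) \<bullet> v - 2 * ((d - p) \<bullet> n) * (n \<bullet> v)"
    by (simp add: reflection_def inner_diff_left algebra_simps)
  also have "\<dots> = - (w \<bullet> v) - 2 * (w \<bullet> n - 2 * (w \<bullet> v) * (n \<bullet> v)) * (n \<bullet> v)"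
    by (simp only: d)
  also have "\<dots> = - (w \<bullet> v) - 2 * (w \<bullet> n) * (n \<bullet> v) + 4 * (w \<bullet> v) * (n \<bullet> v)\<^sup>2"
    by (simp add: algebra_simps power2_eq_square)
  also have "\<dots> = 2 * (w \<bullet> v) * (2 * (n \<bullet> v)\<^sup>2 - 1)"
    using c(1) unfolding w_def[symmetric] by (simp add: algebra_simps)
  also have "\<dots> \<noteq> 0"
    using c(2) angle by (simp add: w_def)
  finally show ?thesis
    by (simp add: reflection_fixed_iff[OF v])
qed

section \<open>Angles between lines in the plane\<close>

lemma affine_hull_2_diff:
  fixes p q :: "'a :: real_vector"
  assumes "x \<in> affine hull {p, q}" "y \<in> affine hull {p, q}"
  obtains k where "y - x = k *\<^sub>R (q - p)"
proof -
  from assms obtain a b where "x = p + a *\<^sub>R (q - p)" "y = p + b *\<^sub>R (q - p)"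
    unfolding affine_hull_2_alt by blast
  then have "y - x = (b - a) *\<^sub>R (q - p)"
    by (simp add: scaleR_diff_left)
  then show ?thesis
    using that by blast
qed

lemma lines_meet_at_angle_cos:
  assumes "lines_meet_at_angle L M \<theta>" "x \<in> L" "y \<in> L" "x' \<in> M" "y' \<in> M"
  shows "\<bar>(y - x) \<bullet> (y' - x')\<bar> = norm (y - x) * norm (y' - x') * cos \<theta>"
proof -
  obtain p q r where pqr: "q \<noteq> p" "r \<noteq> p" "L = affine hull {p, q}" "M = affine hull {p, r}"
      "\<theta> = arccos (\<bar>(q - p) \<bullet> (r - p)\<bar> / (norm (q - p) * norm (r - p)))"
    using assms(1) unfolding lines_meet_at_angle_def by blast
  have "\<bar>(q - p) \<bullet> (r - p)\<bar> / (norm (q - p) * norm (r - p)) \<le> 1"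
    using pqr(1,2) Cauchy_Schwarz_ineq2[of "q - p" "r - p"] by (simp add: divide_le_eq_1)
  moreover have "0 \<le> \<bar>(q - p) \<bullet> (r - p)\<bar> / (norm (q - p) * norm (r - p))"
    by simp
  ultimately have "cos \<theta> = \<bar>(q - p) \<bullet> (r - p)\<bar> / (norm (q - p) * norm (r - p))"
    unfolding pqr(5) by (intro cos_arccos) linarith+
  then have *: "\<bar>(q - p) \<bullet> (r - p)\<bar> = norm (q - p) * norm (r - p) * cos \<theta>"
    using pqr(1,2) by simp
  obtain k where k: "y - x = k *\<^sub>R (q - p)"
    using assms(2,3) pqr(3) affine_hull_2_diff by metis
  obtain l where l: "y' - x' = l *\<^sub>R (r - p)"
    using assms(4,5) pqr(4) affine_hull_2_diff by metis
  show ?thesis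
    unfolding k l using * by (simp add: abs_mult)
qed

lemma plane_orthonormal_expansion:
  fixes n :: "real^2"
  assumes "norm n = 1"
  obtains e where "norm e = 1" "n \<bullet> e = 0" "\<And>x y. x \<bullet> y = (x \<bullet> n) * (y \<bullet> n) + (x \<bullet> e) * (y \<bullet> e)"
proof -
  have n: "n$1 * n$1 + n$2 * n$2 = 1"
    using assms by (simp add: norm_eq_1 inner_vec_def sum_2)
  define e :: "real^2" where "e = vector [- n$2, n$1]"
  have "norm e = 1"
    using n by (simp add: norm_eq_1 e_def inner_vec_def sum_2)
  moreover have "n \<bullet> e = 0"
    by (simp add: e_def inner_vec_def sum_2)
  moreover have "x \<bullet> y = (x \<bullet> n) * (y \<bullet> n) + (x \<bullet> e) * (y \<bullet> e)" for x y
  proof -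
    have "x \<bullet> y = (x$1 * y$1 + x$2 * y$2) * (n$1 * n$1 + n$2 * n$2)"
      unfolding n by (simp add: inner_vec_def sum_2)
    also have "\<dots> = (x \<bullet> n) * (y \<bullet> n) + (x \<bullet> e) * (y \<bullet> e)"
      by (simp add: e_def inner_vec_def sum_2 algebra_simps)
    finally show ?thesis .
  qed
  ultimately show ?thesis
    using that by blast
qed

text \<open>
  Let \<open>n\<close>, \<open>e\<close> be an orthonormal basis of the plane. If the lines spanned by \<open>w\<close> and \<open>e\<close> enclose
  the same angle as those spanned by \<open>v\<close> and \<open>n\<close>, then the two products that make up \<open>w \<bullet> v\<close> in
  this basis have the same absolute value. Hence they cancel or are equal. In the application,
  cancellation is the case that \<open>E C\<close> is perpendicular to \<open>P C\<close>, where \<open>E G C\<close> degenerates;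
  the conclusion says that the mirror image of \<open>w\<close> in the line spanned by \<open>e\<close> is orthogonal
  to \<open>v\<close>.
\<close>

lemma inner_eq_twice_product:
  fixes n e v w :: "'a :: real_inner"
  assumes expand: "\<And>x y. x \<bullet> y = (x \<bullet> n) * (y \<bullet> n) + (x \<bullet> e) * (y \<bullet> e)"
    and v: "norm v = 1" "\<bar>v \<bullet> n\<bar> = c" and w: "\<bar>w \<bullet> e\<bar> = norm w * c" "w \<bullet> v \<noteq> 0"
  shows "w \<bullet> v = 2 * (w \<bullet> n) * (n \<bullet> v)"
proof -
  have "(v \<bullet> n)\<^sup>2 = c\<^sup>2" "(w \<bullet> e)\<^sup>2 = (w \<bullet> w) * c\<^sup>2"
    using v(2) w(1) by (metis power2_abs, metis power2_abs power_mult_distrib power2_norm_eq_inner)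
  moreover have "(v \<bullet> n)\<^sup>2 + (v \<bullet> e)\<^sup>2 = 1" "(w \<bullet> n)\<^sup>2 + (w \<bullet> e)\<^sup>2 = w \<bullet> w"
    using expand[of v v] expand[of w w] v(1) by (simp_all add: power2_eq_square norm_eq_1)
  ultimately have "(v \<bullet> e)\<^sup>2 = 1 - c\<^sup>2" "(w \<bullet> n)\<^sup>2 = (w \<bullet> w) * (1 - c\<^sup>2)"
    by (auto simp: algebra_simps)
  then have "((w \<bullet> n) * (v \<bullet> n))\<^sup>2 = ((w \<bullet> e) * (v \<bullet> e))\<^sup>2"
    using \<open>(v \<bullet> n)\<^sup>2 = c\<^sup>2\<close> \<open>(w \<bullet> e)\<^sup>2 = (w \<bullet> w) * c\<^sup>2\<close>
    by (simp add: power_mult_distrib)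
  then have "(w \<bullet> n) * (v \<bullet> n) = (w \<bullet> e) * (v \<bullet> e)"
    using w(2) expand[of w v] by (auto simp: power2_eq_iff)
  then show ?thesis
    using expand[of w v] by (simp add: inner_commute)
qed

section \<open>The quadrilateral\<close>

theorem theorem5p3:
  fixes A B C P E G D :: "real^2" and \<alpha> :: real
  assumes "\<not> collinear {A, B, C}"
    and "\<not> (dist A B = dist B C \<and> dist B C = dist C A)"
    and "C \<notin> perp_bisector A B"
    and "same_side (perp_bisector A B) C B"
    and "0 < \<alpha>" and "\<alpha> < pi / 4"
    and "P \<in> affine hull {A, B}" and "B \<in> open_segment A P"
    and "lines_meet_at_angle (affine hull {P, B}) (affine hull {P, C}) \<alpha>"
    and "E \<in> perp_bisector A B"
    and "lines_meet_at_angle (affine hull {C, E}) (perp_bisector A B) \<alpha>"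
    and "G \<in> affine hull {P, C}"
    and "\<not> collinear {E, G, C}" and "orthogonal (E - G) (C - G)"
    and "D = 2 *\<^sub>R G - C"
  shows "discrete_pompeiu UNIV isometry_group {A, B, C, D}"
proof -
  have AB: "A \<noteq> B" and "A \<noteq> C" "B \<noteq> C"
    using assms(1) by (metis collinear_2 insert_absorb2 insert_commute)+
  have "G \<noteq> C"
    using assms(13) by auto
  have "P \<noteq> A" "P \<noteq> B"
    using assms(8) by (auto simp: open_segment_def)
  define n where "n = sgn (B - A)"
  define v where "v = sgn (G - C)"
  have n: "norm n = 1" and v: "norm v = 1"
    using AB \<open>G \<noteq> C\<close> by (simp_all add: n_def v_def norm_sgn)
  obtain e where e: "norm e = 1" "n \<bullet> e = 0"
      and expand: "\<And>x y. x \<bullet> y = (x \<bullet> n) * (y \<bullet> n) + (x \<bullet> e) * (y \<bullet> e)"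
    using plane_orthonormal_expansion[OF n] by metis

  \<comment> \<open>The lines \<open>A B\<close>, \<open>P C\<close> and \<open>m\<close> have the directions \<open>n\<close>, \<open>v\<close> and \<open>e\<close>.\<close>
  have "A \<in> affine hull {P, B}"
    using assms(7) \<open>P \<noteq> B\<close> AB by (metis collinear_3_affine_hull insert_commute)
  then have BG: "\<bar>(B - A) \<bullet> (G - C)\<bar> = norm (B - A) * norm (G - C) * cos \<alpha>"
    using lines_meet_at_angle_cos[OF assms(9)] assms(12) by (simp add: hull_inc)
  have vn: "\<bar>v \<bullet> n\<bar> = cos \<alpha>"
  proof -
    have "v \<bullet> n = ((B - A) \<bullet> (G - C)) / (norm (B - A) * norm (G - C))"
      by (simp add: n_def v_def sgn_div_norm inner_commute divide_inverse)
    then show ?thesis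
      using BG AB \<open>G \<noteq> C\<close> by simp
  qed

  have En: "(E - midpoint A B) \<bullet> (B - A) = 0"
    using assms(10) by (simp add: perp_bisector_def orthogonal_def)
  have "(B - A) \<bullet> e = 0"
    using e(2) AB by (simp add: n_def sgn_div_norm)
  then have "E + e \<in> perp_bisector A B"
    using En by (simp add: perp_bisector_def orthogonal_def inner_add_right
        inner_diff_left inner_diff_right inner_commute)
  then have "\<bar>(C - E) \<bullet> e\<bar> = norm (C - E) * cos \<alpha>"
    using lines_meet_at_angle_cos[OF assms(11), of E C E "E + e"] assms(10) e(1)
    by (simp add: hull_inc)

  have GE: "(E - G) \<bullet> (C - G) = 0"
    using assms(14) by (simp add: orthogonal_def)
  then have "(C - E) \<bullet> (G - C) = - ((G - C) \<bullet> (G - C))"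
    by (simp add: inner_diff_left inner_diff_right inner_commute)
  then have wv0: "(C - E) \<bullet> v \<noteq> 0"
    using \<open>G \<noteq> C\<close> by (simp add: v_def sgn_div_norm)
  have wv: "(C - E) \<bullet> v = 2 * ((C - E) \<bullet> n) * (n \<bullet> v)"
    by (rule inner_eq_twice_product[OF expand v vn]) fact+

  have "cos (pi / 4) < cos \<alpha>"
    using assms(5,6) by (intro cos_monotone_0_pi) auto
  then have "1 / 2 < (cos \<alpha>)\<^sup>2"
    using power_strict_mono[of "cos (pi / 4)" "cos \<alpha>" 2]
    by (simp add: cos_45 power_divide)
  then have angle: "2 * (n \<bullet> v)\<^sup>2 \<noteq> 1"
    using vn by (metis inner_commute less_irrefl mult.commute nonzero_eq_divide_eq power2_abs
        zero_neq_numeral)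

  define \<sigma> where "\<sigma> = reflection E n"
  define \<tau> where "\<tau> = reflection E v"
  have \<sigma>: "\<sigma> \<in> isometry_group" "\<sigma> (\<sigma> x) = x" "\<sigma> A = B" for x
    unfolding \<sigma>_def using reflection_isometry[OF n] reflection_reflection[OF n]
      reflection_swaps[OF AB En] by (simp_all add: n_def)
  have "D - C = 2 *\<^sub>R (G - C)" "midpoint C D = G"
    by (simp_all add: assms(15) midpoint_def scaleR_2)
  then have "D \<noteq> C" "sgn (D - C) = v" "(E - midpoint C D) \<bullet> (D - C) = 0"
    using \<open>G \<noteq> C\<close> GE by (auto simp: v_def sgn_scaleR inner_diff_right)
  then have "\<tau> C = D"
    using reflection_swaps[of C D E] by (simp add: \<tau>_def)
  moreover have "(\<sigma> C - E) \<bullet> v = 0"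
    using wv by (simp add: \<sigma>_def reflection_def inner_diff_left)
  ultimately have \<tau>: "\<tau> \<in> isometry_group" "\<tau> (\<tau> x) = x" "\<tau> C = D" "\<tau> (\<sigma> C) = \<sigma> C" for x
    unfolding \<tau>_def using reflection_isometry[OF v] reflection_reflection[OF v]
    by (simp_all add: reflection_fixed_iff[OF v])

  have "\<tau> (\<sigma> D) \<noteq> \<sigma> D"
    using reflection_moves_outer_point[OF n v wv wv0 angle] \<tau>(3) by (simp add: \<sigma>_def \<tau>_def)
  then have outer: "D \<noteq> \<sigma> (\<tau> (\<sigma> D))"
    using \<sigma>(2) by metis

  \<comment> \<open>\<open>D\<close> lies on the line \<open>P C\<close>, which meets the line \<open>A B\<close> only in \<open>P\<close>.\<close>
  have "P \<noteq> C"
    using assms(1,7) AB by (auto simp: collinear_3_affine_hull)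
  have "D \<in> affine hull {P, C}"
  proof -
    obtain t where "G = P + t *\<^sub>R (C - P)"
      using assms(12) unfolding affine_hull_2_alt by blast
    then have "D = 2 *\<^sub>R (P + t *\<^sub>R (C - P)) - C"
      by (simp only: assms(15))
    also have "\<dots> = P + (2 * t - 1) *\<^sub>R (C - P)"
      by (simp add: algebra_simps scaleR_2)
    finally have "D = P + (2 * t - 1) *\<^sub>R (C - P)" .
    then show ?thesis
      unfolding affine_hull_2_alt by blast
  qed
  then have PCD: "collinear {P, C, D}"
    using \<open>P \<noteq> C\<close> by (simp add: collinear_3_affine_hull)
  have ABP: "collinear {A, B, P}"
    using AB assms(7) by (simp add: collinear_3_affine_hull)
  have "D \<noteq> A"
  proof
    assume "D = A"
    then have "collinear {B, A, C}"
      using collinear_3_trans[of B A P C] ABP PCD \<open>P \<noteq> A\<close> by (simp add: insert_commute)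
    then show False
      using assms(1) by (simp add: insert_commute)
  qed
  have "D \<noteq> B"
  proof
    assume "D = B"
    then have "collinear {A, B, C}"
      using collinear_3_trans[of A B P C] ABP PCD \<open>P \<noteq> B\<close> by (simp add: insert_commute)
    then show False
      using assms(1) by simp
  qed

  have "f x = 0"
    if f: "\<forall>\<phi>\<in>isometry_group. (\<Sum>x\<in>{A, B, C, D}. f (\<phi> x)) = 0" for f :: "real^2 \<Rightarrow> complex" and x
  proof -
    have sum0: "f (\<phi> A) + f (\<phi> B) + f (\<phi> C) + f (\<phi> D) = 0" if "\<phi> \<in> isometry_group" for \<phi>
      using f that AB \<open>A \<noteq> C\<close> \<open>B \<noteq> C\<close> \<open>D \<noteq> A\<close> \<open>D \<noteq> B\<close> \<open>D \<noteq> C\<close> by (auto simp: add.assoc)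
    have "f (\<phi> D) = f (\<phi> (\<sigma> (\<tau> (\<sigma> D))))" if "\<phi> \<in> isometry_group" for \<phi>
      using outer_values_agree[OF sum0 isometry_group_comp \<sigma> \<tau> that] .
    then have const: "f y = f x" for y
      using constant_if_equal_on_congruent_pairs[OF _ outer, of f] by simp
    show ?thesis
      using sum0[OF \<sigma>(1)] const[of "\<sigma> A"] const[of "\<sigma> B"] const[of "\<sigma> C"] const[of "\<sigma> D"]
      by simp
  qed
  then show ?thesis
    by (auto simp: discrete_pompeiu_def isometry_group_def)
qed

end
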